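(* $${}_2F_1\left(\tfrac12,\tfrac56;\tfrac76;\tfrac{27}{32}\right)=\frac1{20}\,\frac{\sqrt[3]{2}\,\sqrt6\,\Gamma(1/3)^6}{\pi^3}.$$
   Context: For complex $a,b,c$ with $c\notin\{0,-1,-2,\dots\}$ and $|x|<1$, ${}_2F_1(a,b;c;x)=\sum_{n\ge 0}\frac{(a,n)(b,n)}{(c,n)(1,n)}x^n$ denotes Gauss's hypergeometric series, where $(\alpha,n)=\alpha(\alpha+1)\cdots(\alpha+n-1)$, $(\alpha,0)=1$. All roots are positive real roots. *)

theory Defs
  imports "HOL-Analysis.Analysis"
begin

(* The intended domain is c not a nonpositive integer and norm x < 1; outside of it the
   value carries no meaning. *)
definition hyp2F1 :: "complex \<Rightarrow> complex \<Rightarrow> complex \<Rightarrow> complex \<Rightarrow> complex" where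
  "hyp2F1 a b c x =
     (\<Sum>n. (pochhammer a n * pochhammer b n) / (pochhammer c n * pochhammer 1 n) * x ^ n)"

lemma hyp2F1_eq_eval_fps: "hyp2F1 a b c x = eval_fps (fps_hypergeo [a, b] [c] 1) x"
  by (simp add: hyp2F1_def eval_fps_def pochhammer_fact [symmetric] mult.commute)

lemma hyp2F1_summable:
  fixes a b c x :: complex
  assumes "norm x < 1"
  shows "summable (\<lambda>n. (pochhammer a n * pochhammer b n) /
                        (pochhammer c n * pochhammer 1 n) * x ^ n)"
proof -
  define t where "t = (\<lambda>n. (pochhammer a n * pochhammer b n) /
                        (pochhammer c n * pochhammer 1 n) * x ^ n)"
  define q where "q = (\<lambda>n. ((a + of_nat n) / (c + of_nat n)) *
                            ((b + of_nat n) / (1 + of_nat n)) * x)"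
  have t_Suc: "t (Suc n) = q n * t n" for n
    by (simp add: t_def q_def pochhammer_Suc mult_ac divide_inverse)
  have lim: "(\<lambda>n. (u + of_nat n) / (v + of_nat n)) \<longlonglongrightarrow> 1" for u v :: complex
  proof -
    have "(\<lambda>n. u / of_nat n) \<longlonglongrightarrow> 0" "(\<lambda>n. v / of_nat n) \<longlonglongrightarrow> 0"
      by (auto intro: lim_const_over_n)
    then have "(\<lambda>n. (u / of_nat n + 1) / (v / of_nat n + 1)) \<longlonglongrightarrow> (0 + 1) / (0 + 1)"
      by (intro tendsto_intros) auto
    moreover have "eventually (\<lambda>n. (u / of_nat n + 1) / (v / of_nat n + 1) =
        (u + of_nat n) / (v + of_nat n)) sequentially"
      using eventually_gt_at_top[of 0]
    proof eventually_elim
      case (elim n)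
      then have *: "u / of_nat n + 1 = (u + of_nat n) / of_nat n"
        "v / of_nat n + 1 = (v + of_nat n) / of_nat n"
        by (auto simp: field_simps)
      show ?case unfolding * using elim by simp
    qed
    ultimately show ?thesis
      by (simp add: filterlim_cong)
  qed
  have "q \<longlonglongrightarrow> 1 * 1 * x"
    unfolding q_def by (intro tendsto_mult lim tendsto_const)
  then have "(\<lambda>n. norm (q n)) \<longlonglongrightarrow> norm x"
    by (simp add: tendsto_norm)
  moreover obtain r where r: "norm x < r" "r < 1"
    using assms dense by blast
  ultimately have "eventually (\<lambda>n. norm (q n) < r) sequentially"
    by (auto dest: order_tendstoD)
  then obtain N where "\<And>n. n \<ge> N \<Longrightarrow> norm (q n) < r"
    by (auto simp: eventually_at_top_linorder)
  then have "summable t"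
    using r(2) by (intro summable_ratio_test[of r N])
      (auto simp: t_Suc norm_mult intro!: mult_right_mono intro: less_imp_le)
  then show ?thesis
    by (simp add: t_def)
qed

end

theory Submission
  imports Defs
begin

text \<open>
  By Euler's integral with \<open>b = 1/2\<close> the value is, up to a Beta factor, the length of a side of the
  Schwarz--Christoffel quadrilateral with angles 90, 120, 120, 30 degrees and prevertices
  \<open>0, 1, \<infinity>, 32/27\<close>. For this cross ratio the quadrilateral is tiled by five triangles
  with angles 30, 60, 90 degrees, so the integrand is the pullback of
  \<open>z\<^sup>-\<^sup>1\<^sup>/\<^sup>2 (1 - z)\<^sup>-\<^sup>5\<^sup>/\<^sup>6 dz\<close> under a rational function of degree 5, which turns out to map
  \<open>[0, 1]\<close> monotonically onto itself. This gives \<open>Beta (1/2) (1/6)\<close>.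
\<close>

section \<open>Euler's integral for the hypergeometric series\<close>

lemma gbinomial_uminus_sums:
  fixes a z :: real
  assumes "\<bar>z\<bar> < 1"
  shows "(\<lambda>n. pochhammer a n / fact n * z ^ n) sums (1 - z) powr (- a)"
proof -
  have "(\<lambda>n. (- a gchoose n) * (- z) ^ n) sums (1 + - z) powr (- a)"
    using assms by (intro gen_binomial_real) auto
  moreover have "(- a gchoose n) * (- z) ^ n = pochhammer a n / fact n * z ^ n" for n
  proof -
    have "(- 1) ^ n * (- z) ^ n = z ^ n"
      by (simp flip: power_mult_distrib)
    then show ?thesis
      by (simp add: gbinomial_pochhammer mult_ac)
  qed
  ultimately show ?thesis
    by simp
qed

lemma Beta_add_nat_left:
  fixes a b :: real
  assumes "a > 0" "b > 0"
  shows "Beta (a + real n) b = pochhammer a n / pochhammer (a + b) n * Beta a b"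
proof -
  have "a \<notin> \<int>\<^sub>\<le>\<^sub>0" "a + b \<notin> \<int>\<^sub>\<le>\<^sub>0"
    using assms by (auto elim!: nonpos_Ints_cases)
  moreover have "Gamma a > 0" "Gamma (a + b) > 0" "Gamma (a + b + real n) > 0"
    using assms by (auto intro!: Gamma_real_pos)
  ultimately show ?thesis
    by (simp add: Beta_def pochhammer_Gamma field_simps)
qed

text \<open>Expanding the factor \<open>(1 - x * t) powr (- a)\<close> binomially leaves the moments
  of a Beta weight, whose ratios to the total mass are Pochhammer quotients. Dominated convergence
  justifies integrating term by term.\<close>

theorem hypergeometric_Euler_integral:
  fixes a b c x :: real
  assumes b: "0 < b" "b < c" and x: "\<bar>x\<bar> < 1"
    and I: "((\<lambda>t. t powr (b - 1) * (1 - t) powr (c - b - 1) * (1 - x * t) powr (- a))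
              has_integral I) {0..1}"
  shows "(\<lambda>n. pochhammer a n * pochhammer b n / (pochhammer c n * fact n) * x ^ n)
           sums (I / Beta b (c - b))"
proof -
  define w where "w = (\<lambda>t. t powr (b - 1) * (1 - t) powr (c - b - 1))"
  define d where "d = (\<lambda>n. pochhammer a n / fact n)"
  define B where "B = Beta b (c - b)"
  define T where "T = (\<lambda>n. pochhammer a n * pochhammer b n / (pochhammer c n * fact n) * x ^ n)"
  have "B > 0"
    using b by (auto simp: B_def Beta_def intro!: divide_pos_pos mult_pos_pos Gamma_real_pos)
  have w_int: "((\<lambda>t. w t * t ^ n) has_integral (pochhammer b n / pochhammer c n * B)) {0..1}" for n
  proof -
    have "((\<lambda>t. t powr (b + real n - 1) * (1 - t) powr (c - b - 1))
            has_integral Beta (b + real n) (c - b)) {0..1}"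
      using b by (intro has_integral_Beta_real) auto
    \<comment> \<open>At \<open>t = 0\<close> both sides vanish, even for \<open>n = 0\<close>,
      because \<open>0 powr y = 0\<close> for every \<open>y\<close>.\<close>
    moreover have "t powr (b + real n - 1) * (1 - t) powr (c - b - 1) = w t * t ^ n"
      if "t \<in> {0..1}" for t
    proof (cases "t = 0")
      case False
      then have "t powr (b + real n - 1) = t powr (b - 1) * t ^ n"
        using that by (simp add: powr_add powr_diff powr_realpow)
      then show ?thesis
        by (simp add: w_def)
    qed (simp add: w_def)
    ultimately have "((\<lambda>t. w t * t ^ n) has_integral Beta (b + real n) (c - b)) {0..1}"
      by (subst has_integral_cong[where g = "\<lambda>t. t powr (b + real n - 1) * (1 - t) powr (c - b - 1)"])
        auto
    then show ?thesis
      using b by (simp add: Beta_add_nat_left B_def)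
  qed
  \<comment> \<open>Convergence at the slightly larger \<open>r\<close> gives absolute convergence
    at \<open>x\<close>, hence a bound \<open>K\<close> uniform in \<open>t\<close>.\<close>
  obtain r where r: "\<bar>x\<bar> < r" "r < 1"
    using x dense by blast
  have "summable (\<lambda>n. d n * r ^ n)"
    using gbinomial_uminus_sums[of r a] r by (auto simp: d_def sums_iff)
  then have abs_sum: "summable (\<lambda>n. \<bar>d n * x ^ n\<bar>)"
    using powser_insidea[of d r x] r by simp
  define K where "K = (\<Sum>n. \<bar>d n * x ^ n\<bar>)"
  define S where "S = (\<lambda>N t. \<Sum>n<N. d n * x ^ n * (w t * t ^ n))"
  have S_int: "(S N has_integral (\<Sum>n<N. T n * B)) {0..1}" for N
  proof -
    have "(S N has_integral
            (\<Sum>n<N. d n * x ^ n * (pochhammer b n / pochhammer c n * B))) {0..1}"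
      unfolding S_def by (intro has_integral_sum has_integral_mult_right w_int) auto
    then show ?thesis
      by (simp add: T_def d_def mult_ac)
  qed
  \<comment> \<open>The factor \<open>t ^ 0\<close> makes the dominating function the case
    \<open>n = 0\<close> of \<open>w_int\<close>.\<close>
  have dom: "norm (S N t) \<le> K * (w t * t ^ 0)" if "t \<in> {0..1}" for N t
  proof -
    have "w t \<ge> 0"
      by (simp add: w_def)
    have "norm (S N t) \<le> (\<Sum>n<N. \<bar>d n * x ^ n\<bar> * w t)"
      unfolding S_def
    proof (rule sum_norm_le)
      fix n
      have "t ^ n \<le> 1" "t ^ n \<ge> 0"
        using that by (auto intro: power_le_one)
      then have "w t * t ^ n \<le> w t"
        using \<open>w t \<ge> 0\<close> by (simp add: mult_left_le)
      then show "norm (d n * x ^ n * (w t * t ^ n)) \<le> \<bar>d n * x ^ n\<bar> * w t"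
        using \<open>w t \<ge> 0\<close> \<open>t ^ n \<ge> 0\<close> unfolding real_norm_def
        by (subst abs_mult) (auto intro!: mult_left_mono)
    qed
    also have "\<dots> \<le> K * w t"
      unfolding K_def sum_distrib_right[symmetric]
      using \<open>w t \<ge> 0\<close> abs_sum by (intro mult_right_mono sum_le_suminf) auto
    finally show ?thesis
      by simp
  qed
  have conv: "(\<lambda>N. S N t) \<longlonglongrightarrow> w t * (1 - x * t) powr (- a)" if "t \<in> {0..1}" for t
  proof -
    have "\<bar>x * t\<bar> \<le> \<bar>x\<bar>"
      using that by (auto simp: abs_mult mult_left_le)
    then have "(\<lambda>n. d n * (x * t) ^ n) sums (1 - x * t) powr (- a)"
      using x gbinomial_uminus_sums[of "x * t" a] by (simp add: d_def)
    then have "(\<lambda>n. w t * (d n * (x * t) ^ n)) sums (w t * (1 - x * t) powr (- a))"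
      by (rule sums_mult)
    then show ?thesis
      by (simp add: sums_def S_def power_mult_distrib mult_ac)
  qed
  have "(\<lambda>N. integral {0..1} (S N)) \<longlonglongrightarrow> integral {0..1} (\<lambda>t. w t * (1 - x * t) powr (- a))"
  proof (rule dominated_convergence(2))
    show "S N integrable_on {0..1}" for N
      using S_int by blast
    show "(\<lambda>t. K * (w t * t ^ 0)) integrable_on {0..1}"
      using has_integral_mult_right[OF w_int[of 0]] by blast
  qed (use dom conv in auto)
  then have "(\<lambda>n. T n * B) sums I"
    using integral_unique[OF S_int] integral_unique[OF I] by (simp add: sums_def w_def)
  then have "(\<lambda>n. T n * B / B) sums (I / B)"
    by (rule sums_divide)
  then have "T sums (I / B)"
    using \<open>B > 0\<close> by simp
  then show ?thesis
    by (simp only: T_def B_def)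
qed

section \<open>The Euler integral as a pullback of a Beta integral\<close>

text \<open>The exponents stay unsimplified to match Euler's integral with \<open>a = 5/6\<close>,
  \<open>b = 1/2\<close>, \<open>c = 7/6\<close>. The constant comes from the behaviour at 0: there
  \<open>z t\<close> is asymptotic to \<open>75/32 * t\<close>, so the pulled back form starts with
  \<open>sqrt (75/32) * t powr (- 1/2)\<close>.\<close>

lemma has_integral_pullback_Beta:
  "((\<lambda>t::real. t powr (1/2 - 1) * (1 - t) powr (7/6 - 1/2 - 1) * (1 - 27/32 * t) powr (- (5/6)))
      has_integral (Beta (1/2) (1/6) / sqrt (75/32))) {0..1}"
proof -
  \<comment> \<open>The coefficients of \<open>z\<close> are determined by its ramification: two double zeros at the roots of \<open>q\<close>,
    \<open>z = 1\<close> to order 4 at \<open>1\<close> and order 1 at \<open>32/27\<close>, poles of order 3 at \<open>6/5\<close> and order 2 at \<open>\<infinity>\<close>.\<close>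
  define q where "q = (\<lambda>t::real. 1 - 14/9 * t + 3/5 * t\<^sup>2)"
  define z where "z = (\<lambda>t::real. 75/32 * t * (q t)\<^sup>2 / (1 - 5/6 * t) ^ 3)"
  define z' where "z' = (\<lambda>t::real. 75/32 * q t * (1 - t) ^ 3 / (1 - 5/6 * t) ^ 4)"
  define f where "f = (\<lambda>u::real. u powr (1/2 - 1) * (1 - u) powr (1/6 - 1))"
  define g where "g = (\<lambda>t::real. t powr (1/2 - 1) * (1 - t) powr (7/6 - 1/2 - 1) *
                              (1 - 27/32 * t) powr (- (5/6)))"
  have q_pos: "q t > 0" if "t \<in> {0..1}" for t
  proof -
    \<comment> \<open>\<open>q\<close> has two real zeros, both beyond 1, so no sum of squares is
      available. Splitting off \<open>q 1 = 2/45\<close> leaves a quadratic with the root 1.\<close>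
    have "q t = 2/45 + (1 - t) * (43/45 - 27/45 * t)"
      by (simp add: q_def field_simps power2_eq_square)
    moreover have "(1 - t) * (43/45 - 27/45 * t) \<ge> 0"
      using that by (intro mult_nonneg_nonneg) auto
    ultimately show ?thesis
      by linarith
  qed
  have deriv: "(z has_field_derivative z' t) (at t)" if "t \<in> {0..1}" for t
  proof -
    define v where "v = 1 - 5/6 * t"
    have v: "v \<noteq> 0"
      using that by (auto simp: v_def)
    have "(z has_field_derivative
            ((75/32 * (q t)\<^sup>2 + 75/32 * t * (2 * q t * (6/5 * t - 14/9))) * v ^ 3
               + 75/32 * t * (q t)\<^sup>2 * (3 * v\<^sup>2 * (5/6))) / (v ^ 3 * v ^ 3)) (at t)"
      unfolding z_def q_def v_def using that
      by (auto intro!: derivative_eq_intros simp: power2_eq_square field_simps)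
    \<comment> \<open>The factors reflect the ramification: \<open>q t\<close> from the double
      zeros, \<open>(1 - t) ^ 3\<close> from the fourfold value 1 at 1. The factor
      \<open>v\<^sup>2\<close> cancels, leaving a pole of order 4.\<close>
    moreover have "((75/32 * (q t)\<^sup>2 + 75/32 * t * (2 * q t * (6/5 * t - 14/9))) * v ^ 3
               + 75/32 * t * (q t)\<^sup>2 * (3 * v\<^sup>2 * (5/6)))
              = 75/32 * q t * v\<^sup>2 * (1 - t) ^ 3"
      unfolding q_def v_def by algebra
    moreover have "75/32 * q t * v\<^sup>2 * (1 - t) ^ 3 / (v ^ 3 * v ^ 3) = z' t"
      unfolding z'_def v_def[symmetric] using v by (simp add: field_simps flip: power_add)
    ultimately show ?thesis
      by (simp only:)
  qed
  have z'_pos: "z' t > 0" if "t \<in> {0<..<1}" for t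
    using that q_pos[of t] by (simp add: z'_def)
  have cont: "continuous_on {0..1} z"
    by (meson DERIV_isCont continuous_at_imp_continuous_on deriv)
  \<comment> \<open>Since \<open>z' 1 = 0\<close>, positivity of the derivative is used only in the
    interior.\<close>
  have less: "z s < z t" if "0 \<le> s" "s < t" "t \<le> 1" for s t
  proof (rule DERIV_pos_imp_increasing_open[OF \<open>s < t\<close>])
    show "\<exists>y. (z has_real_derivative y) (at u) \<and> 0 < y" if "s < u" "u < t" for u
      using that \<open>0 \<le> s\<close> \<open>t \<le> 1\<close> deriv[of u] z'_pos[of u] by auto
    show "continuous_on {s..t} z"
      using that by (intro continuous_on_subset[OF cont]) auto
  qed
  have z01: "z 0 = 0" "z 1 = 1"
    by (simp_all add: z_def q_def power2_eq_square power3_eq_cube)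
  have image: "z ` {0<..<1} = {0<..<1}"
  proof
    show "z ` {0<..<1} \<subseteq> {0<..<1}"
      using less[of 0] less[of _ 1] z01 by force
    show "{0<..<1} \<subseteq> z ` {0<..<1}"
    proof
      fix y :: real assume y: "y \<in> {0<..<1}"
      then obtain t where "0 \<le> t" "t \<le> 1" "z t = y"
        using IVT'[of z 0 y 1] cont z01 by auto
      then show "y \<in> z ` {0<..<1}"
        using y z01 by (cases "t = 0 \<or> t = 1") auto
    qed
  qed
  have inj: "inj_on z {0<..<1}"
    by (intro strict_mono_on_imp_inj_on strict_mono_onI less) auto
  have one_minus_z: "1 - z t = (1 - 27/32 * t) * (1 - t) ^ 4 / (1 - 5/6 * t) ^ 3"
    if "t \<in> {0<..<1}" for t
  proof -
    have "(1 - 5/6 * t) ^ 3 - 75/32 * t * (q t)\<^sup>2 = (1 - 27/32 * t) * (1 - t) ^ 4"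
      unfolding q_def by algebra
    then show ?thesis
      using that by (simp add: z_def diff_divide_eq_iff)
  qed
  \<comment> \<open>After taking logarithms this is a comparison of exponents: those of
    \<open>q t\<close> and of \<open>1 - 5/6 * t\<close> cancel, and \<open>1 - t\<close> keeps 3 -
    10/3 = -1/3.\<close>
  have pullback: "\<bar>z' t\<bar> * f (z t) = sqrt (75/32) * g t" if t: "t \<in> {0<..<1}" for t
  proof -
    have pos: "t > 0" "1 - t > 0" "1 - 27/32 * t > 0" "1 - 5/6 * t > 0" "q t > 0"
      using t q_pos[of t] by auto
    have z_pos: "z t > 0" "1 - z t > 0"
      using t image by auto
    have ln_z: "ln (z t) = ln (75/32) + ln t + 2 * ln (q t) - 3 * ln (1 - 5/6 * t)"
      unfolding z_def using pos by (simp add: ln_mult ln_div ln_realpow)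
    have ln_1z: "ln (1 - z t) = ln (1 - 27/32 * t) + 4 * ln (1 - t) - 3 * ln (1 - 5/6 * t)"
      unfolding one_minus_z[OF t] using pos by (simp add: ln_mult ln_div ln_realpow)
    have ln_z': "ln (z' t) = ln (75/32) + ln (q t) + 3 * ln (1 - t) - 4 * ln (1 - 5/6 * t)"
      unfolding z'_def using pos by (simp add: ln_mult ln_div ln_realpow)
    have "ln (z' t * f (z t)) = ln (z' t) - 1/2 * ln (z t) - 5/6 * ln (1 - z t)"
      unfolding f_def using z'_pos[OF t] z_pos by (simp add: ln_mult)
    also have "\<dots> = 1/2 * ln (75/32) - 1/2 * ln t - 1/3 * ln (1 - t) - 5/6 * ln (1 - 27/32 * t)"
      unfolding ln_z ln_1z ln_z' by (simp add: algebra_simps)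
    also have "\<dots> = ln (sqrt (75/32) * g t)"
      unfolding g_def using pos by (simp add: ln_mult ln_sqrt)
    finally show ?thesis
      using z'_pos[OF t] z_pos pos by (subst (asm) ln_inj_iff) (auto simp: f_def g_def)
  qed
  have deriv_within: "(z has_field_derivative z' t) (at t within {0<..<1})"
    if "t \<in> {0<..<1}" for t
    by (rule has_field_derivative_at_within, rule deriv) (use that in auto)
  have f_int: "(f has_integral Beta (1/2) (1/6)) {0<..<1}"
    using has_integral_Beta_real[of "1/2" "1/6"] by (simp add: f_def has_integral_Icc_iff_Ioo)
  then have "f absolutely_integrable_on {0<..<1}"
    by (intro nonnegative_absolutely_integrable_1) (auto simp: f_def)
  then have "f absolutely_integrable_on z ` {0<..<1} \<and> integral (z ` {0<..<1}) f = Beta (1/2) (1/6)"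
    using f_int by (simp add: image integral_unique)
  \<comment> \<open>The change of variables is an equivalence, read here from the image to the
    domain, so integrability of the pulled back function comes out as well.\<close>
  then have "(\<lambda>t. \<bar>z' t\<bar> * f (z t)) absolutely_integrable_on {0<..<1} \<and>
      integral {0<..<1} (\<lambda>t. \<bar>z' t\<bar> * f (z t)) = Beta (1/2) (1/6)"
    using has_absolute_integral_change_of_variables_1'[OF _ deriv_within inj] by simp
  then have "((\<lambda>t. \<bar>z' t\<bar> * f (z t)) has_integral Beta (1/2) (1/6)) {0<..<1}"
    by (metis integrable_integral set_lebesgue_integral_eq_integral(1))
  then have "((\<lambda>t. sqrt (75/32) * g t) has_integral Beta (1/2) (1/6)) {0<..<1}"
    by (subst has_integral_cong[where g = "\<lambda>t. \<bar>z' t\<bar> * f (z t)"]) (use pullback in auto)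
  then have "((\<lambda>t. sqrt (75/32) * g t / sqrt (75/32)) has_integral
      (Beta (1/2) (1/6) / sqrt (75/32))) {0<..<1}"
    by (rule has_integral_divide)
  then show ?thesis
    by (simp add: g_def has_integral_Icc_iff_Ioo)
qed

section \<open>Reduction of the Gamma values to \<open>Gamma (1/3)\<close>\<close>

lemma Gamma_two_thirds_real: "Gamma (2/3 :: real) = 2 * pi / (sqrt 3 * Gamma (1/3))"
proof -
  have "Gamma (1/3 :: complex) * Gamma (1 - 1/3) = of_real pi / sin (of_real pi * (1/3))"
    by (rule Gamma_reflection_complex)
  also have "\<dots> = of_real (pi / sin (pi * (1/3)))"
    by (simp flip: sin_of_real)
  also have "sin (pi * (1/3)) = sqrt 3 / 2"
    using sin_60 by simp
  finally have "complex_of_real (Gamma (1/3) * Gamma (2/3)) = of_real (2 * pi / sqrt 3)"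
    by (simp flip: Gamma_complex_of_real)
  then have "Gamma (1/3) * Gamma (2/3) = 2 * pi / sqrt 3"
    by (subst (asm) of_real_eq_iff)
  moreover have "Gamma (1/3 :: real) > 0"
    by (simp add: Gamma_real_pos)
  ultimately have "Gamma (2/3) = 2 * pi / sqrt 3 / Gamma (1/3 :: real)"
    by (metis less_irrefl mult.commute nonzero_eq_divide_eq)
  then show ?thesis
    by simp
qed

lemma Gamma_one_sixth_real:
  "Gamma (1/6 :: real) = 2 powr (2/3) * sqrt pi * Gamma (1/3) / Gamma (2/3)"
proof -
  have "(1/6 :: complex) \<notin> \<int>\<^sub>\<le>\<^sub>0" "(1/6 + 1/2 :: complex) \<notin> \<int>\<^sub>\<le>\<^sub>0"
    by (auto elim!: nonpos_Ints_cases simp: complex_eq_iff)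
  then have "Gamma (1/6 :: complex) * Gamma (1/6 + 1/2) =
      exp ((1 - 2 * (1/6)) * of_real (ln 2)) * of_real (sqrt pi) * Gamma (2 * (1/6))"
    by (rule Gamma_legendre_duplication)
  then have "complex_of_real (Gamma (1/6) * Gamma (2/3)) =
      of_real (exp (2/3 * ln 2) * sqrt pi * Gamma (1/3))"
    by (simp flip: Gamma_complex_of_real exp_of_real)
  then have "Gamma (1/6) * Gamma (2/3) = exp (2/3 * ln 2) * sqrt pi * Gamma (1/3 :: real)"
    by (subst (asm) of_real_eq_iff)
  moreover have "Gamma (2/3 :: real) > 0"
    by (simp add: Gamma_real_pos)
  ultimately have "Gamma (1/6) = exp (2/3 * ln 2) * sqrt pi * Gamma (1/3) / Gamma (2/3 :: real)"
    by (metis less_irrefl nonzero_eq_divide_eq)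
  then show ?thesis
    by (simp add: powr_def)
qed

text \<open>The quotient is a multiple of \<open>(Gamma (1/6) / Gamma (2/3))\<^sup>2\<close>. By
  duplication and reflection the numerator contributes \<open>G ^ 4 / pi\<close> and the denominator
  \<open>G\<^sup>2 / pi\<^sup>2\<close>; the cube root survives because
  \<open>r ^ 4 = 2 * r\<close>.\<close>

lemma Beta_quotient_eq:
  "Beta (1/2) (1/6) / sqrt (75/32) / Beta (1/2) (2/3) =
     1/20 * (root 3 2 * sqrt 6 * Gamma (1/3) ^ 6 / pi ^ 3 :: real)"
proof -
  define G where "G = (Gamma (1/3) :: real)"
  define r where "r = root 3 2"
  have G: "G > 0"
    by (simp add: G_def Gamma_real_pos)
  have r: "r > 0" "r ^ 3 = 2"
    by (simp_all add: r_def)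
  have "(2::real) powr (2/3) = (2 powr (1/3)) powr 2"
    by (simp add: powr_powr)
  then have two: "(2::real) powr (2/3) = r\<^sup>2"
    by (simp add: r_def root_powr_inverse powr_numeral)
  have g7: "Gamma (7/6 :: real) = 1/6 * Gamma (1/6)"
  proof -
    have "(1/6 :: real) \<notin> \<int>\<^sub>\<le>\<^sub>0"
      by (auto elim!: nonpos_Ints_cases)
    then show ?thesis
      using Gamma_plus1[of "1/6 :: real"] by simp
  qed
  have sq: "sqrt (75/32) = 5 * sqrt 6 / (8 :: real)"
  proof (rule real_sqrt_unique)
    show "(5 * sqrt 6 / 8)\<^sup>2 = (75/32 :: real)"
      by (simp add: power2_eq_square)
  qed simp
  have g6: "Gamma (1/6 :: real) = r\<^sup>2 * sqrt 3 * G\<^sup>2 / (2 * sqrt pi)"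
    using G by (simp add: Gamma_one_sixth_real Gamma_two_thirds_real two flip: G_def)
      (simp add: field_simps power2_eq_square)
  have "Beta (1/2) (1/6) / sqrt (75/32) / Beta (1/2) (2/3) =
      Gamma (1/6) * Gamma (7/6) / (sqrt (75/32) * Gamma (2/3) * Gamma (2/3 :: real))"
    by (simp add: Beta_def Gamma_one_half_real)
  also have "\<dots> = (Gamma (1/6))\<^sup>2 * 8 / (30 * sqrt 6 * (Gamma (2/3 :: real))\<^sup>2)"
    by (simp add: g7 sq power2_eq_square)
  also have "(Gamma (1/6 :: real))\<^sup>2 = r ^ 4 * 3 * G ^ 4 / (4 * pi)"
    by (simp add: g6 power_mult_distrib power_divide flip: power_mult)
  also have "r ^ 4 = 2 * r"
    using r by (simp add: power4_eq_xxxx power3_eq_cube)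
  also have "(Gamma (2/3 :: real))\<^sup>2 = 4 * pi\<^sup>2 / (3 * G\<^sup>2)"
    by (simp add: Gamma_two_thirds_real power_mult_distrib power_divide flip: G_def)
  also have "2 * r * 3 * G ^ 4 / (4 * pi) * 8 / (30 * sqrt 6 * (4 * pi\<^sup>2 / (3 * G\<^sup>2)))
      = 1/20 * (r * sqrt 6 * G ^ 6 / pi ^ 3)"
    using G by (simp add: field_simps power_def numeral_eq_Suc)
  finally show ?thesis
    by (simp add: r_def G_def)
qed

theorem mainTheorem17:
  shows "hyp2F1 (1/2) (5/6) (7/6) (27/32) =
    complex_of_real (1 / 20 * ((root 3 2 * sqrt 6 * Gamma (1/3) ^ 6) / pi ^ 3))"
proof -
  \<comment> \<open>The upper parameters are exchanged, which leaves the series unchanged, so that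
    1/2 takes the role of \<open>b\<close> in Euler's integral.\<close>
  let ?T = "\<lambda>n. pochhammer (5/6) n * pochhammer (1/2) n / (pochhammer (7/6) n * fact n) *
    (27/32) ^ n :: real"
  have T: "?T sums (Beta (1/2) (1/6) / sqrt (75/32) / Beta (1/2) (7/6 - 1/2))"
    by (rule hypergeometric_Euler_integral[OF _ _ _ has_integral_pullback_Beta]) auto
  have "(7/6 - 1/2 :: real) = 2/3"
    by simp
  then have "(\<lambda>n. complex_of_real (?T n)) sums
      of_real (1/20 * (root 3 2 * sqrt 6 * Gamma (1/3) ^ 6 / pi ^ 3))"
    using T by (simp only: sums_of_real_iff Beta_quotient_eq)
  moreover have "complex_of_real (?T n) =
      pochhammer (1/2) n * pochhammer (5/6) n / (pochhammer (7/6) n * pochhammer 1 n) *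
        (27/32) ^ n" for n
    by (simp add: pochhammer_fact mult_ac flip: pochhammer_of_real)
  ultimately show ?thesis
    unfolding hyp2F1_def by (simp add: sums_iff)
qed

end
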